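(* Let $\mathcal{C}$ be the collection of all classes over the feature set $\mathcal{N}=\{\textit{top\_symbol},\textit{has\_symbol}\}$, with equality of classes understood as equality of semantic representations at every feature. Let $\wedge$ and $\vee$ be the featurewise meet and join of classes, let $\top$ be the most general class and let $\bot$ be the empty class. Then $(\mathcal{C},\vee,\wedge,\top,\bot)$ is a bounded lattice, with $C\vee\bot=C$ and $C\wedge\top=C$ for every class $C$.
   Context: Let $\mathcal{N}=\{\textit{top\_symbol},\textit{has\_symbol}\}$ be the set of feature names. A datum is an atomic piece of data (here, a symbol). A class $C$ assigns to each feature $f\in\mathcal{N}$ a value $C(f)$. This value is either a finite list of finite lists of data, or one of two special values $\top_f$ (most general) and $\bot_f$ (least general). A list of lists is read as a formula in disjunctive normal form; for example $[[a,b],[c]]$ is read as $(a\wedge b)\vee c$. A feature left unspecified in a class imposes no constraint, i.e. has value $\top_f$. Semantic representation: for each feature $f$, fix a universal set $\mathbb{U}$ and an interpretation of each datum $a$ as a set $[\![a]\!]\subseteq\mathbb{U}$ (these may depend on $f$). The semantic representation $x^s\subseteq\mathbb{U}$ of a value $x$ is $$[[a_1,\dots,a_m],\dots,[b_1,\dots,b_n]]^s=([\![a_1]\!]\cap\cdots\cap[\![a_m]\!])\cup\cdots\cup([\![b_1]\!]\cap\cdots\cap[\![b_n]\!]),$$ with $\top_f^s=\mathbb{U}$ and $\bot_f^s=\emptyset$ (empty intersections are $\mathbb{U}$, empty unions are $\emptyset$). Values are identified when their semantic representations are equal, and two classes are equal iff they have equal semantic representation at every $f\in\mathcal{N}$.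 Operations: $C_1\wedge C_2$ and $C_1\vee C_2$ are the classes given, for every $f\in\mathcal{N}$, by $(C_1\wedge C_2)(f)=C_1(f)\wedge_f C_2(f)$ and $(C_1\vee C_2)(f)=C_1(f)\vee_f C_2(f)$. Here $C_1(f)\wedge_f C_2(f)$ is the value with semantic representation $C_1(f)^s\cap C_2(f)^s$, and $C_1(f)\vee_f C_2(f)$ is the value with semantic representation $C_1(f)^s\cup C_2(f)^s$. Such values exist as disjunctive normal forms up to semantic equality. The class $\top$ has $\top(f)=\top_f$ for all $f$, and the class $\bot$ has $\bot(f)=\bot_f$ for all $f$. *)

theory Defs
  imports "HOL-Algebra.Lattice"
begin

datatype feature = Top_Symbol | Has_Symbol

text \<open>The type variable \<open>'d\<close> is the type of data. The constructor \<open>DNF\<close> carries a list of lists,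
  read as a disjunction of conjunctions.\<close>

datatype 'd fvalue = Most_General | Least_General | DNF "'d list list"

text \<open>A class is a total assignment of values: a feature that is left unspecified has the value
  \<^const>\<open>Most_General\<close>. Every such assignment is a class.\<close>

type_synonym 'd cls = "feature \<Rightarrow> 'd fvalue"

text \<open>The universal set \<open>U f\<close> and the interpretation \<open>I f a\<close> of a datum \<open>a\<close> may depend on the
  feature \<open>f\<close>.\<close>

definition interpretation_of_data :: "(feature \<Rightarrow> 'u set) \<Rightarrow> (feature \<Rightarrow> 'd \<Rightarrow> 'u set) \<Rightarrow> bool" where
  "interpretation_of_data U I \<longleftrightarrow> (\<forall>f a. I f a \<subseteq> U f)"

text \<open>Intersecting with \<open>U f\<close> only matters for the empty conjunction, which denotes \<open>U f\<close>.\<close>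

fun val_sem :: "(feature \<Rightarrow> 'u set) \<Rightarrow> (feature \<Rightarrow> 'd \<Rightarrow> 'u set) \<Rightarrow> feature \<Rightarrow> 'd fvalue \<Rightarrow> 'u set" where
  "val_sem U I f Most_General = U f"
| "val_sem U I f Least_General = {}"
| "val_sem U I f (DNF css) = (\<Union>cs\<in>set css. U f \<inter> (\<Inter>a\<in>set cs. I f a))"

definition cls_eq :: "(feature \<Rightarrow> 'u set) \<Rightarrow> (feature \<Rightarrow> 'd \<Rightarrow> 'u set) \<Rightarrow> 'd cls \<Rightarrow> 'd cls \<Rightarrow> bool" where
  "cls_eq U I C D \<longleftrightarrow> (\<forall>f. val_sem U I f (C f) = val_sem U I f (D f))"

text \<open>Meet and join of values are determined up to semantic equality only, so a representative is
  chosen; the lemmas \<open>val_sem_meet\<close> and \<open>val_sem_join\<close> below show that one always exists.\<close>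

definition val_meet :: "(feature \<Rightarrow> 'u set) \<Rightarrow> (feature \<Rightarrow> 'd \<Rightarrow> 'u set) \<Rightarrow> feature
    \<Rightarrow> 'd fvalue \<Rightarrow> 'd fvalue \<Rightarrow> 'd fvalue" where
  "val_meet U I f x y = (SOME z. val_sem U I f z = val_sem U I f x \<inter> val_sem U I f y)"

definition val_join :: "(feature \<Rightarrow> 'u set) \<Rightarrow> (feature \<Rightarrow> 'd \<Rightarrow> 'u set) \<Rightarrow> feature
    \<Rightarrow> 'd fvalue \<Rightarrow> 'd fvalue \<Rightarrow> 'd fvalue" where
  "val_join U I f x y = (SOME z. val_sem U I f z = val_sem U I f x \<union> val_sem U I f y)"

definition cls_meet :: "(feature \<Rightarrow> 'u set) \<Rightarrow> (feature \<Rightarrow> 'd \<Rightarrow> 'u set) \<Rightarrow> 'd cls \<Rightarrow> 'd cls \<Rightarrow> 'd cls" where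
  "cls_meet U I C D = (\<lambda>f. val_meet U I f (C f) (D f))"

definition cls_join :: "(feature \<Rightarrow> 'u set) \<Rightarrow> (feature \<Rightarrow> 'd \<Rightarrow> 'u set) \<Rightarrow> 'd cls \<Rightarrow> 'd cls \<Rightarrow> 'd cls" where
  "cls_join U I C D = (\<lambda>f. val_join U I f (C f) (D f))"

definition cls_top :: "'d cls" where "cls_top = (\<lambda>f. Most_General)"

definition cls_bot :: "'d cls" where "cls_bot = (\<lambda>f. Least_General)"

lemma val_sem_DNF_exists: "\<exists>css. val_sem U I f x = val_sem U I f (DNF css)"
proof (cases x)
  case Most_General
  then show ?thesis by (intro exI[of _ "[[]]"]) simp
next
  case Least_General
  then show ?thesis by (intro exI[of _ "[]"]) simp
next
  case (DNF css)
  then show ?thesis by blast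
qed

lemma val_sem_meet: "val_sem U I f (val_meet U I f x y) = val_sem U I f x \<inter> val_sem U I f y"
proof -
  obtain xs where xs: "val_sem U I f x = val_sem U I f (DNF xs)"
    using val_sem_DNF_exists[of U I f x] ..
  obtain ys where ys: "val_sem U I f y = val_sem U I f (DNF ys)"
    using val_sem_DNF_exists[of U I f y] ..
  define K where "K cs = U f \<inter> (\<Inter>a\<in>set cs. I f a)" for cs
  have K_append: "K (a @ b) = K a \<inter> K b" for a b
    unfolding K_def by auto
  have K_union: "val_sem U I f (DNF css) = (\<Union>cs\<in>set css. K cs)" for css
    unfolding K_def by simp
  have "(\<Union>cs\<in>set [a @ b. a \<leftarrow> xs, b \<leftarrow> ys]. K cs) = (\<Union>a\<in>set xs. \<Union>b\<in>set ys. K (a @ b))"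
    by simp
  then have "val_sem U I f (DNF [a @ b. a \<leftarrow> xs, b \<leftarrow> ys]) = val_sem U I f x \<inter> val_sem U I f y"
    by (simp only: xs ys K_union K_append Int_UN_distrib2)
  then show ?thesis
    unfolding val_meet_def by (rule someI[where P = "\<lambda>z. val_sem U I f z = val_sem U I f x \<inter> val_sem U I f y"])
qed

lemma val_sem_join: "val_sem U I f (val_join U I f x y) = val_sem U I f x \<union> val_sem U I f y"
proof -
  obtain xs where xs: "val_sem U I f x = val_sem U I f (DNF xs)"
    using val_sem_DNF_exists[of U I f x] ..
  obtain ys where ys: "val_sem U I f y = val_sem U I f (DNF ys)"
    using val_sem_DNF_exists[of U I f y] ..
  have "val_sem U I f (DNF (xs @ ys)) = val_sem U I f x \<union> val_sem U I f y"
    unfolding xs ys by (simp add: Int_Un_distrib)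
  then show ?thesis
    unfolding val_join_def by (rule someI[where P = "\<lambda>z. val_sem U I f z = val_sem U I f x \<union> val_sem U I f y"])
qed

text \<open>A bounded lattice as an algebraic structure, on a carrier set whose equality is the
  equivalence relation of the structure. The two congruence axioms say that the operations are
  well defined with respect to this equality.\<close>

locale bounded_lattice_algebra = equivalence L for L (structure) +
  fixes jn mt :: "'a \<Rightarrow> 'a \<Rightarrow> 'a" and tp bt :: 'a
  assumes jn_closed: "\<lbrakk>x \<in> carrier L; y \<in> carrier L\<rbrakk> \<Longrightarrow> jn x y \<in> carrier L"
    and mt_closed: "\<lbrakk>x \<in> carrier L; y \<in> carrier L\<rbrakk> \<Longrightarrow> mt x y \<in> carrier L"
    and tp_closed: "tp \<in> carrier L"
    and bt_closed: "bt \<in> carrier L"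
    and jn_cong: "\<lbrakk>x \<in> carrier L; x' \<in> carrier L; y \<in> carrier L; y' \<in> carrier L; x .= x'; y .= y'\<rbrakk>
      \<Longrightarrow> jn x y .= jn x' y'"
    and mt_cong: "\<lbrakk>x \<in> carrier L; x' \<in> carrier L; y \<in> carrier L; y' \<in> carrier L; x .= x'; y .= y'\<rbrakk>
      \<Longrightarrow> mt x y .= mt x' y'"
    and jn_comm: "\<lbrakk>x \<in> carrier L; y \<in> carrier L\<rbrakk> \<Longrightarrow> jn x y .= jn y x"
    and mt_comm: "\<lbrakk>x \<in> carrier L; y \<in> carrier L\<rbrakk> \<Longrightarrow> mt x y .= mt y x"
    and jn_assoc: "\<lbrakk>x \<in> carrier L; y \<in> carrier L; z \<in> carrier L\<rbrakk> \<Longrightarrow> jn (jn x y) z .= jn x (jn y z)"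
    and mt_assoc: "\<lbrakk>x \<in> carrier L; y \<in> carrier L; z \<in> carrier L\<rbrakk> \<Longrightarrow> mt (mt x y) z .= mt x (mt y z)"
    and jn_absorb: "\<lbrakk>x \<in> carrier L; y \<in> carrier L\<rbrakk> \<Longrightarrow> jn x (mt x y) .= x"
    and mt_absorb: "\<lbrakk>x \<in> carrier L; y \<in> carrier L\<rbrakk> \<Longrightarrow> mt x (jn x y) .= x"
    and jn_bt: "x \<in> carrier L \<Longrightarrow> jn x bt .= x"
    and mt_tp: "x \<in> carrier L \<Longrightarrow> mt x tp .= x"

text \<open>All classes, with semantic equality and with the lattice order induced by the meet.\<close>

definition cls_lattice :: "(feature \<Rightarrow> 'u set) \<Rightarrow> (feature \<Rightarrow> 'd \<Rightarrow> 'u set) \<Rightarrow> 'd cls gorder" where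
  "cls_lattice U I = \<lparr>carrier = UNIV, eq = cls_eq U I, le = (\<lambda>C D. cls_eq U I (cls_meet U I C D) C)\<rparr>"

end

theory Submission
  imports Defs
begin

text \<open>Sending a class to the family of its semantic sets, one subset of \<open>U f\<close> per
  feature, turns semantic equality into equality, meet and join into intersection and union, and the
  two extreme classes into \<open>U f\<close> and the empty set (\<open>val_sem_cls\<close>). Every
  claim thus reduces, feature by feature, to a fact about the lattice of subsets of
  \<open>U f\<close>; \<open>le_cls_lattice\<close> does the same for the order.\<close>

lemma val_sem_subset: "val_sem U I f x \<subseteq> U f"
  by (cases x) auto

lemma val_sem_cls_meet:
  "val_sem U I f (cls_meet U I C D f) = val_sem U I f (C f) \<inter> val_sem U I f (D f)"
  by (simp add: cls_meet_def val_sem_meet)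

lemma val_sem_cls_join:
  "val_sem U I f (cls_join U I C D f) = val_sem U I f (C f) \<union> val_sem U I f (D f)"
  by (simp add: cls_join_def val_sem_join)

lemma val_sem_cls_top: "val_sem U I f (cls_top f) = U f"
  by (simp add: cls_top_def)

lemma val_sem_cls_bot: "val_sem U I f (cls_bot f) = {}"
  by (simp add: cls_bot_def)

lemmas val_sem_cls = val_sem_cls_meet val_sem_cls_join val_sem_cls_top val_sem_cls_bot

lemma carrier_cls_lattice: "carrier (cls_lattice U I) = UNIV"
  by (simp add: cls_lattice_def)

lemma eq_cls_lattice:
  "C .=\<^bsub>cls_lattice U I\<^esub> D \<longleftrightarrow> (\<forall>f. val_sem U I f (C f) = val_sem U I f (D f))"
  by (simp add: cls_lattice_def cls_eq_def)

text \<open>Since A \<inter> B = A exactly when A \<subseteq> B, the order induced by the meet is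
  inclusion at each feature, so bounds become questions about inclusion.\<close>

lemma le_cls_lattice:
  "C \<sqsubseteq>\<^bsub>cls_lattice U I\<^esub> D \<longleftrightarrow> (\<forall>f. val_sem U I f (C f) \<subseteq> val_sem U I f (D f))"
  by (auto simp: cls_lattice_def cls_eq_def val_sem_cls)

lemmas cls_lattice_simps = carrier_cls_lattice eq_cls_lattice le_cls_lattice

text \<open>Only the weak form is available: different formulas can denote the same set, so
  antisymmetry gives semantic equality and not identity.\<close>

lemma weak_partial_order_cls_lattice: "weak_partial_order (cls_lattice U I)"
  by unfold_locales (simp_all add: cls_lattice_simps, blast+)

lemma is_lub_cls_join: "is_lub (cls_lattice U I) (cls_join U I C D) {C, D}"
  by (auto simp: least_def Upper_def cls_lattice_simps val_sem_cls)

lemma is_glb_cls_meet: "is_glb (cls_lattice U I) (cls_meet U I C D) {C, D}"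
  by (auto simp: greatest_def Lower_def cls_lattice_simps val_sem_cls)

lemma greatest_cls_top: "greatest (cls_lattice U I) cls_top (carrier (cls_lattice U I))"
  by (simp add: greatest_def cls_lattice_simps val_sem_cls val_sem_subset)

lemma least_cls_bot: "least (cls_lattice U I) cls_bot (carrier (cls_lattice U I))"
  by (simp add: least_def cls_lattice_simps val_sem_cls)

lemma weak_bounded_lattice_cls_lattice: "weak_bounded_lattice (cls_lattice U I)"
proof -
  interpret weak_partial_order "cls_lattice U I"
    by (rule weak_partial_order_cls_lattice)
  show ?thesis
    \<comment> \<open>What remains are existence claims, with join, meet, \<open>cls_top\<close> and
      \<open>cls_bot\<close> as witnesses.\<close>
    by unfold_locales (use is_lub_cls_join is_glb_cls_meet greatest_cls_top least_cls_bot in blast)+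
qed

lemma bounded_lattice_algebra_cls_lattice:
  "bounded_lattice_algebra (cls_lattice U I) (cls_join U I) (cls_meet U I) cls_top cls_bot"
  by unfold_locales
    \<comment> \<open>The law for \<open>cls_top\<close> needs more than set algebra: intersecting
      with \<open>U f\<close> changes nothing because every value denotes a subset of
      \<open>U f\<close>.\<close>
    (auto simp: cls_lattice_simps val_sem_cls Int_absorb2[OF val_sem_subset] Un_assoc Int_assoc)

theorem mainTheorem1:
  fixes U :: "feature \<Rightarrow> 'u set" and I :: "feature \<Rightarrow> 'd \<Rightarrow> 'u set"
  assumes "interpretation_of_data U I"
  shows "bounded_lattice_algebra (cls_lattice U I) (cls_join U I) (cls_meet U I) cls_top cls_bot
    \<and> weak_bounded_lattice (cls_lattice U I)
    \<and> (\<forall>C D. is_lub (cls_lattice U I) (cls_join U I C D) {C, D})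
    \<and> (\<forall>C D. is_glb (cls_lattice U I) (cls_meet U I C D) {C, D})
    \<and> greatest (cls_lattice U I) cls_top (carrier (cls_lattice U I))
    \<and> least (cls_lattice U I) cls_bot (carrier (cls_lattice U I))
    \<and> (\<forall>C. cls_eq U I (cls_join U I C cls_bot) C)
    \<and> (\<forall>C. cls_eq U I (cls_meet U I C cls_top) C)"
  by (simp add: bounded_lattice_algebra_cls_lattice weak_bounded_lattice_cls_lattice
      is_lub_cls_join is_glb_cls_meet greatest_cls_top least_cls_bot
      cls_eq_def val_sem_cls Int_absorb2[OF val_sem_subset])

end
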